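(* Let $q$ be an odd integer larger than $3$, $\kappa>0$ and $M\in\mathbb R_+$. There exist positive $\epsilon_0$ and $C$ such that for any closed interval $I\subset\mathbb R$ and any smooth functions $\omega:I\to\mathbb R$, $\omega_0:I\to\mathbb R$ and $F:I\to\mathbb C$ such that - $|\omega'''|$ and $|\omega_0'''|$ are larger than $\kappa$ and smaller than $M$ on $I$; - $|\omega''|$ and $|\omega_0''|$ vanish at some $\xi_*\in I$ such that $I\subset[\xi_*-\epsilon_0,\xi_*+\epsilon_0]$; - $G:=F\times|\cdot-\xi_*|$ and $H:=F'\times|\cdot-\xi_*|^2$ are bounded; - $|\omega^{(\ell)}-\omega_0^{(\ell)}|\times|\cdot-\xi_*|^{-q+\ell}$ is bounded by $M$ for any $0\le\ell\le2$; then for any $|t|\ge1$, $$\left|\int_I\big(e^{i\,\omega(\xi)t}-e^{i\,\omega_0(\xi)t}\big)\,F(\xi)\,d\xi\right|\ \le\ \frac{C}{|t|^{(q-3)/(2q)}}\ \left[\,\sup_I|G|+\sup_I|H|\,\right].$$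
   Context: Here $\omega^{(\ell)}$ denotes the $\ell$th derivative of $\omega$. The constants $\epsilon_0$ and $C$ depend only on $q,\kappa,M$. *)

theory Defs
  imports "HOL-Analysis.Analysis"
begin

text \<open>
  Derivatives are taken within \<open>I\<close>, so that they are the one-sided ones at the endpoints of a
  closed interval. They are uniquely determined only if \<open>I\<close> has no isolated points; the
  definitions below are meant for nondegenerate intervals.
\<close>

primrec nth_deriv_on ::
  "real set \<Rightarrow> nat \<Rightarrow> (real \<Rightarrow> 'a::real_normed_vector) \<Rightarrow> real \<Rightarrow> 'a"
where
  "nth_deriv_on I 0 f = f"
| "nth_deriv_on I (Suc n) f = (\<lambda>x. vector_derivative (nth_deriv_on I n f) (at x within I))"

definition smooth_on_interval :: "real set \<Rightarrow> (real \<Rightarrow> 'a::real_normed_vector) \<Rightarrow> bool" where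
  "smooth_on_interval I f \<longleftrightarrow>
     (\<forall>n. \<forall>x\<in>I. nth_deriv_on I n f differentiable (at x within I))"

end

theory Submission
  imports Defs
begin

text \<open>
  Write \<open>x = \<bar>\<xi> - \<xi>\<^sub>s\<bar>\<close> and treat the two sides of \<open>\<xi>\<^sub>s\<close> separately, each as an interval
  \<open>{0..c}\<close>.  The third derivatives do not vanish, so they keep their sign, and \<open>\<omega>''\<close> and
  \<open>\<omega>\<^sub>0''\<close> are at least \<open>\<kappa> * x\<close> in absolute value, with a constant sign on each side.  Van der
  Corput's second derivative test then bounds the tail \<open>\<integral>\<^sub>x\<^sup>c exp (i \<omega> t)\<close> by a constant times
  \<open>(\<kappa> \<bar>t\<bar> x) powr (-1/2)\<close>, and likewise for \<open>\<omega>\<^sub>0\<close>.  Integration by parts against this tail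
  (\<open>weighted_oscillatory_bound\<close>) shows that an amplitude of size \<open>x powr s\<close>, with derivative of
  size \<open>x powr (s - 1)\<close>, contributes \<open>\<bar>t\<bar> powr (-1/2) * x powr (s - 1/2)\<close>, evaluated at one end
  of the interval of integration.

  The interval is cut at \<open>\<rho> = \<bar>t\<bar> powr (- 1/q)\<close>, the scale at which the phase difference
  \<open>t (\<omega> - \<omega>\<^sub>0)\<close>, which is \<open>O(\<bar>t\<bar> x\<^sup>q)\<close>, becomes of order one.

  For \<open>x \<ge> \<rho>\<close> the two exponentials are estimated separately (\<open>far_estimate\<close>): the amplitude is
  \<open>F\<close>, of size \<open>1/x\<close>, and the bound is \<open>\<bar>t\<bar> powr (-1/2) * \<rho> powr (-3/2)\<close>.

  For \<open>x \<le> \<rho>\<close> the size of the integrand alone is not enough, since \<open>\<bar>t\<bar> x\<^sup>q / x\<close> integrates to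
  \<open>O(1)\<close>.  Instead the integrand is read as \<open>exp (i \<omega>\<^sub>0 t)\<close> times the amplitude
  \<open>F (exp (i (\<omega> - \<omega>\<^sub>0) t) - 1)\<close>, which is \<open>O(\<bar>t\<bar> x powr (q - 1))\<close> and loses one power of \<open>x\<close>
  when differentiated (\<open>near_estimate\<close>).  The cancellation in \<open>exp (i \<omega>\<^sub>0 t)\<close> then gives
  \<open>\<bar>t\<bar> powr (1/2) * \<rho> powr (q - 3/2)\<close>.

  Both bounds equal \<open>\<bar>t\<bar> powr (- (q - 3) / (2 q))\<close>.
\<close>

section \<open>Oscillatory integrals: the van der Corput tests\<close>

lemma increment_ge:
  fixes f :: "real \<Rightarrow> real"
  assumes "a \<le> b"
    and f: "\<And>x. x \<in> {a..b} \<Longrightarrow> (f has_real_derivative f' x) (at x within {a..b})"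
    and m: "\<And>x. x \<in> {a..b} \<Longrightarrow> m \<le> f' x"
  shows "m * (b - a) \<le> f b - f a"
proof -
  have "\<exists>x\<in>{a..b}. f b - f a = f' x * (b - a)"
    using f by (intro mvt_very_simple[OF \<open>a \<le> b\<close>, where f' = "\<lambda>x h. f' x * h"])
      (auto simp: has_field_derivative_def)
  then show ?thesis
    using m \<open>a \<le> b\<close> by (metis diff_ge_0_iff_ge mult_right_mono)
qed

lemma has_vector_derivative_cis:
  assumes "(f has_real_derivative d) (at x within S)"
  shows "((\<lambda>x. cis (f x)) has_vector_derivative of_real d * (\<i> * cis (f x))) (at x within S)"
proof -
  have "(f has_derivative (\<lambda>t. t * d)) (at x within S)"
    using assms by (simp add: has_field_derivative_def mult_commute_abs)
  from has_derivative_cis[OF this] show ?thesis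
    by (simp add: has_vector_derivative_def scaleR_conv_of_real mult_ac)
qed

lemma continuous_on_real_derivative:
  fixes f :: "real \<Rightarrow> real"
  assumes "\<And>x. x \<in> S \<Longrightarrow> (f has_real_derivative f' x) (at x within S)"
  shows "continuous_on S f"
  using assms DERIV_continuous continuous_on_eq_continuous_within by blast

lemma continuous_on_cis_derivative:
  fixes f :: "real \<Rightarrow> real"
  assumes "\<And>x. x \<in> S \<Longrightarrow> (f has_real_derivative f' x) (at x within S)"
  shows "continuous_on S (\<lambda>x. cis (f x))"
  using continuous_on_real_derivative[OF assms] by (intro continuous_intros)

text \<open>
  Integration by parts: \<open>cis \<phi>\<close> is the derivative of \<open>cis \<phi> / (i \<phi>')\<close> up to an error of modulus
  \<open>\<bar>\<phi>''\<bar> / \<phi>'\<^sup>2\<close>.  Since \<open>\<phi>''\<close> is nonnegative, this modulus is the derivative of \<open>- 1 / \<phi>'\<close>, so its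
  integral is again controlled by the endpoint values of \<open>1 / \<phi>'\<close>.
\<close>

lemma first_derivative_test:
  fixes \<phi> \<phi>' \<phi>'' :: "real \<Rightarrow> real"
  assumes "a \<le> b" and "\<mu> > 0"
    and d1: "\<And>x. x \<in> {a..b} \<Longrightarrow> (\<phi> has_real_derivative \<phi>' x) (at x within {a..b})"
    and d2: "\<And>x. x \<in> {a..b} \<Longrightarrow> (\<phi>' has_real_derivative \<phi>'' x) (at x within {a..b})"
    and ge: "\<And>x. x \<in> {a..b} \<Longrightarrow> \<mu> \<le> \<phi>' x"
    and convex: "\<And>x. x \<in> {a..b} \<Longrightarrow> 0 \<le> \<phi>'' x"
  shows "norm (integral {a..b} (\<lambda>x. cis (\<phi> x))) \<le> 2 / \<mu>"
proof -
  define g where "g x = - \<i> * of_real (1 / \<phi>' x) * cis (\<phi> x)" for x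
  define h where "h x = \<i> * of_real (\<phi>'' x / (\<phi>' x)\<^sup>2) * cis (\<phi> x)" for x
  have pos: "\<phi>' x > 0" if "x \<in> {a..b}" for x
    using ge[OF that] \<open>\<mu> > 0\<close> by linarith
  have r: "((\<lambda>x. 1 / \<phi>' x) has_real_derivative - (\<phi>'' x / (\<phi>' x)\<^sup>2)) (at x within {a..b})"
    if "x \<in> {a..b}" for x
    using d2[OF that] pos[OF that]
    by (auto intro!: derivative_eq_intros simp: power2_eq_square divide_simps)
  have dg: "(g has_vector_derivative (cis (\<phi> x) + h x)) (at x within {a..b})"
    if x: "x \<in> {a..b}" for x
  proof -
    have "((\<lambda>x. complex_of_real (1 / \<phi>' x)) has_vector_derivative
        of_real (- (\<phi>'' x / (\<phi>' x)\<^sup>2))) (at x within {a..b})"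
      using r[OF x] has_real_derivative_iff_has_vector_derivative has_vector_derivative_of_real
      by blast
    then have "(g has_vector_derivative
        - \<i> * (of_real (1 / \<phi>' x) * (of_real (\<phi>' x) * (\<i> * cis (\<phi> x)))
        + of_real (- (\<phi>'' x / (\<phi>' x)\<^sup>2)) * cis (\<phi> x))) (at x within {a..b})"
      unfolding g_def mult.assoc
      by (intro has_vector_derivative_mult_right has_vector_derivative_mult
          has_vector_derivative_cis d1 x)
    then show ?thesis
      using pos[OF x] by (simp add: h_def algebra_simps)
  qed
  have ig: "((\<lambda>x. cis (\<phi> x) + h x) has_integral (g b - g a)) {a..b}"
    by (rule fundamental_theorem_of_calculus[OF \<open>a \<le> b\<close> dg])
  have ic: "(\<lambda>x. cis (\<phi> x)) integrable_on {a..b}"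
    using continuous_on_cis_derivative[OF d1] integrable_continuous_real by blast
  have ih: "(h has_integral (g b - g a - integral {a..b} (\<lambda>x. cis (\<phi> x)))) {a..b}"
    using has_integral_diff[OF ig integrable_integral[OF ic]] by simp
  have ir: "((\<lambda>x. \<phi>'' x / (\<phi>' x)\<^sup>2) has_integral (1 / \<phi>' a - 1 / \<phi>' b)) {a..b}"
    using has_integral_neg[OF fundamental_theorem_of_calculus[OF \<open>a \<le> b\<close>,
        of "\<lambda>x. 1 / \<phi>' x" "\<lambda>x. - (\<phi>'' x / (\<phi>' x)\<^sup>2)"]] r
    by (simp add: has_real_derivative_iff_has_vector_derivative)
  have "norm (integral {a..b} h) \<le> integral {a..b} (\<lambda>x. \<phi>'' x / (\<phi>' x)\<^sup>2)"
    using ih ir convex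
    by (intro integral_norm_bound_integral) (auto simp: h_def norm_mult norm_divide norm_power)
  then have "norm (g b - g a - integral {a..b} (\<lambda>x. cis (\<phi> x))) \<le> 1 / \<phi>' a - 1 / \<phi>' b"
    using ih ir by (simp add: integral_unique)
  moreover have "norm (g x) = 1 / \<phi>' x" if "x \<in> {a..b}" for x
    using pos[OF that] by (simp add: g_def norm_mult norm_divide)
  then have "norm (g a) = 1 / \<phi>' a" "norm (g b) = 1 / \<phi>' b"
    using \<open>a \<le> b\<close> by auto
  moreover have "norm (integral {a..b} (\<lambda>x. cis (\<phi> x)))
      \<le> norm (g b) + norm (g a) + norm (g b - g a - integral {a..b} (\<lambda>x. cis (\<phi> x)))"
    using norm_triangle_ineq4[of "g b - g a" "g b - g a - integral {a..b} (\<lambda>x. cis (\<phi> x))"]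
      norm_triangle_ineq4[of "g b" "g a"] by simp
  moreover have "1 / \<phi>' a \<le> 1 / \<mu>"
    using ge[of a] \<open>a \<le> b\<close> \<open>\<mu> > 0\<close> by (intro divide_left_mono) auto
  ultimately have "norm (integral {a..b} (\<lambda>x. cis (\<phi> x))) \<le> 2 * (1 / \<mu>)"
    using \<open>\<mu> > 0\<close> by linarith
  then show ?thesis by simp
qed

text \<open>
  The growth of \<open>\<phi>'\<close> makes it at least \<open>\<mu> * \<delta>\<close> beyond distance \<open>\<delta>\<close> from the left end.  The
  first \<open>\<delta>\<close> is estimated by its length and the rest by the first derivative test; the choice
  \<open>\<delta> = 1 / sqrt \<mu>\<close> balances the two.
\<close>

lemma second_derivative_test_increasing:
  fixes \<phi> \<phi>' \<phi>'' :: "real \<Rightarrow> real"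
  assumes "a \<le> b" and "\<mu> > 0"
    and d1: "\<And>x. x \<in> {a..b} \<Longrightarrow> (\<phi> has_real_derivative \<phi>' x) (at x within {a..b})"
    and d2: "\<And>x. x \<in> {a..b} \<Longrightarrow> (\<phi>' has_real_derivative \<phi>'' x) (at x within {a..b})"
    and ge: "\<And>x. x \<in> {a..b} \<Longrightarrow> \<mu> \<le> \<phi>'' x"
    and start: "0 \<le> \<phi>' a"
  shows "norm (integral {a..b} (\<lambda>x. cis (\<phi> x))) \<le> 3 / sqrt \<mu>"
proof -
  define \<delta> where "\<delta> = 1 / sqrt \<mu>"
  define c where "c = min b (a + \<delta>)"
  have \<delta>: "\<delta> > 0" using \<open>\<mu> > 0\<close> by (simp add: \<delta>_def)
  have c: "a \<le> c" "c \<le> b" using \<open>a \<le> b\<close> \<delta> by (auto simp: c_def)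
  have int: "(\<lambda>x. cis (\<phi> x)) integrable_on {a..b}"
    using continuous_on_cis_derivative[OF d1] integrable_continuous_real by blast
  have 1: "norm (integral {a..c} (\<lambda>x. cis (\<phi> x))) \<le> \<delta>"
  proof -
    have "norm (integral {a..c} (\<lambda>x. cis (\<phi> x))) \<le> integral {a..c} (\<lambda>x. 1::real)"
      using integrable_subinterval_real[OF int, of a c] c
      by (intro integral_norm_bound_integral) auto
    also have "\<dots> \<le> \<delta>" using c by (simp add: c_def)
    finally show ?thesis .
  qed
  have 2: "norm (integral {c..b} (\<lambda>x. cis (\<phi> x))) \<le> 2 * \<delta>"
  proof (cases "c = b")
    case True
    then show ?thesis using \<delta> by simp
  next
    case False
    then have ca: "c = a + \<delta>" by (auto simp: c_def)
    have "norm (integral {c..b} (\<lambda>x. cis (\<phi> x))) \<le> 2 / (\<mu> * \<delta>)"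
    proof (rule first_derivative_test)
      show "(\<phi> has_real_derivative \<phi>' x) (at x within {c..b})" if "x \<in> {c..b}" for x
        using d1[of x] that c by (auto intro: DERIV_subset)
      show "(\<phi>' has_real_derivative \<phi>'' x) (at x within {c..b})" if "x \<in> {c..b}" for x
        using d2[of x] that c by (auto intro: DERIV_subset)
      show "\<mu> * \<delta> \<le> \<phi>' x" if "x \<in> {c..b}" for x
      proof -
        have "\<mu> * (x - a) \<le> \<phi>' x - \<phi>' a"
        proof (rule increment_ge)
          show "(\<phi>' has_real_derivative \<phi>'' y) (at y within {a..x})" if "y \<in> {a..x}" for y
            using d2[of y] that \<open>x \<in> {c..b}\<close> by (auto intro: DERIV_subset)
          show "\<mu> \<le> \<phi>'' y" if "y \<in> {a..x}" for y
            using ge[of y] that \<open>x \<in> {c..b}\<close> by auto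
        qed (use that c in auto)
        moreover have "\<mu> * \<delta> \<le> \<mu> * (x - a)"
          using that ca \<open>\<mu> > 0\<close> by simp
        ultimately show ?thesis using start by linarith
      qed
      show "0 \<le> \<phi>'' x" if "x \<in> {c..b}" for x
        using ge[of x] that c \<open>\<mu> > 0\<close> by auto
    qed (use c \<open>\<mu> > 0\<close> \<delta> in auto)
    also have "\<mu> * \<delta> = sqrt \<mu>"
      using \<open>\<mu> > 0\<close> by (simp add: \<delta>_def real_div_sqrt)
    finally show ?thesis by (simp add: \<delta>_def)
  qed
  have "integral {a..b} (\<lambda>x. cis (\<phi> x))
      = integral {a..c} (\<lambda>x. cis (\<phi> x)) + integral {c..b} (\<lambda>x. cis (\<phi> x))"
    using Henstock_Kurzweil_Integration.integral_combine[OF c int] by simp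
  then have "norm (integral {a..b} (\<lambda>x. cis (\<phi> x))) \<le> 3 * \<delta>"
    using 1 2 norm_triangle_ineq[of "integral {a..c} (\<lambda>x. cis (\<phi> x))"
        "integral {c..b} (\<lambda>x. cis (\<phi> x))"] by simp
  then show ?thesis by (simp add: \<delta>_def)
qed

text \<open>
  The mirror image of the previous case under \<open>x \<mapsto> - x\<close>.
\<close>

lemma second_derivative_test_decreasing:
  fixes \<phi> \<phi>' \<phi>'' :: "real \<Rightarrow> real"
  assumes "a \<le> b" and "\<mu> > 0"
    and d1: "\<And>x. x \<in> {a..b} \<Longrightarrow> (\<phi> has_real_derivative \<phi>' x) (at x within {a..b})"
    and d2: "\<And>x. x \<in> {a..b} \<Longrightarrow> (\<phi>' has_real_derivative \<phi>'' x) (at x within {a..b})"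
    and ge: "\<And>x. x \<in> {a..b} \<Longrightarrow> \<mu> \<le> \<phi>'' x"
    and stop: "\<phi>' b \<le> 0"
  shows "norm (integral {a..b} (\<lambda>x. cis (\<phi> x))) \<le> 3 / sqrt \<mu>"
proof -
  have refl: "((\<lambda>x. f (- x)) has_real_derivative - f' (- x)) (at x within {- b..- a})"
    if "(f has_real_derivative f' (- x)) (at (- x) within {a..b})" for f f' :: "real \<Rightarrow> real" and x
  proof -
    have "(f has_real_derivative f' (- x)) (at (- x) within uminus ` {- b..- a})"
      using that by simp
    from DERIV_image_chain[OF this, of "-1"] show ?thesis
      using DERIV_minus[OF DERIV_ident, of x "{- b..- a}"] unfolding o_def by simp
  qed
  have "norm (integral {- b..- a} (\<lambda>x. cis (\<phi> (- x)))) \<le> 3 / sqrt \<mu>"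
  proof (rule second_derivative_test_increasing)
    show "((\<lambda>x. \<phi> (- x)) has_real_derivative - \<phi>' (- x)) (at x within {- b..- a})"
      if "x \<in> {- b..- a}" for x
      using refl[of \<phi> \<phi>' x] d1[of "- x"] that by auto
    show "((\<lambda>x. - \<phi>' (- x)) has_real_derivative \<phi>'' (- x)) (at x within {- b..- a})"
      if "x \<in> {- b..- a}" for x
      using DERIV_minus[OF refl[of \<phi>' \<phi>'' x]] d2[of "- x"] that by auto
    show "\<mu> \<le> \<phi>'' (- x)" if "x \<in> {- b..- a}" for x
      using that by (intro ge) auto
  qed (use assms in auto)
  then show ?thesis
    by (simp add: Henstock_Kurzweil_Integration.integral_reflect_real[of b a "\<lambda>x. cis (\<phi> x)"])
qed

text \<open>
  The derivative \<open>\<phi>'\<close> is increasing, so it has at most one zero.  The interval is cut there, which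
  leaves a one-sided case on either side; without a zero the whole interval is one-sided.
\<close>

lemma second_derivative_test:
  fixes \<phi> \<phi>' \<phi>'' :: "real \<Rightarrow> real"
  assumes "a \<le> b" and "\<mu> > 0"
    and d1: "\<And>x. x \<in> {a..b} \<Longrightarrow> (\<phi> has_real_derivative \<phi>' x) (at x within {a..b})"
    and d2: "\<And>x. x \<in> {a..b} \<Longrightarrow> (\<phi>' has_real_derivative \<phi>'' x) (at x within {a..b})"
    and ge: "\<And>x. x \<in> {a..b} \<Longrightarrow> \<mu> \<le> \<phi>'' x"
  shows "norm (integral {a..b} (\<lambda>x. cis (\<phi> x))) \<le> 6 / sqrt \<mu>"
proof -
  have int: "(\<lambda>x. cis (\<phi> x)) integrable_on {a..b}"
    using continuous_on_cis_derivative[OF d1] integrable_continuous_real by blast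
  have sub: "(f has_real_derivative y) (at x within {u..v})"
    if "(f has_real_derivative y) (at x within {a..b})" "a \<le> u" "v \<le> b" for f y x u v
    using that by (auto intro: DERIV_subset)
  have cont: "continuous_on {a..b} \<phi>'"
    by (rule continuous_on_real_derivative[OF d2])
  consider "0 \<le> \<phi>' a" | "\<phi>' b \<le> 0" | "\<phi>' a \<le> 0" "0 \<le> \<phi>' b" by linarith
  then show ?thesis
  proof cases
    case 1
    have "norm (integral {a..b} (\<lambda>x. cis (\<phi> x))) \<le> 3 / sqrt \<mu>"
      by (rule second_derivative_test_increasing[OF assms 1])
    also have "\<dots> \<le> 6 / sqrt \<mu>" using \<open>\<mu> > 0\<close> by (simp add: divide_right_mono)
    finally show ?thesis .
  next
    case 2
    have "norm (integral {a..b} (\<lambda>x. cis (\<phi> x))) \<le> 3 / sqrt \<mu>"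
      by (rule second_derivative_test_decreasing[OF assms 2])
    also have "\<dots> \<le> 6 / sqrt \<mu>" using \<open>\<mu> > 0\<close> by (simp add: divide_right_mono)
    finally show ?thesis .
  next
    case 3
    then obtain z where z: "a \<le> z" "z \<le> b" "\<phi>' z = 0"
      using IVT'[of \<phi>' a 0 b] cont \<open>a \<le> b\<close> by blast
    have "norm (integral {a..z} (\<lambda>x. cis (\<phi> x))) \<le> 3 / sqrt \<mu>"
      by (rule second_derivative_test_decreasing[of _ _ _ _ \<phi>' \<phi>''])
        (use z \<open>\<mu> > 0\<close> in \<open>auto intro: sub[OF d1] sub[OF d2] ge\<close>)
    moreover have "norm (integral {z..b} (\<lambda>x. cis (\<phi> x))) \<le> 3 / sqrt \<mu>"
      by (rule second_derivative_test_increasing[of _ _ _ _ \<phi>' \<phi>''])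
        (use z \<open>\<mu> > 0\<close> in \<open>auto intro: sub[OF d1] sub[OF d2] ge\<close>)
    moreover have "integral {a..b} (\<lambda>x. cis (\<phi> x))
        = integral {a..z} (\<lambda>x. cis (\<phi> x)) + integral {z..b} (\<lambda>x. cis (\<phi> x))"
      using Henstock_Kurzweil_Integration.integral_combine[OF z(1,2) int] by simp
    ultimately show ?thesis
      using norm_triangle_ineq[of "integral {a..z} (\<lambda>x. cis (\<phi> x))"
          "integral {z..b} (\<lambda>x. cis (\<phi> x))"] by simp
  qed
qed

text \<open>
  Replacing \<open>\<phi>\<close> by \<open>- \<phi>\<close> conjugates the integral, which reduces a negative \<open>\<phi>''\<close> to a
  positive one.
\<close>

lemma second_derivative_test_abs:
  fixes \<phi> \<phi>' \<phi>'' :: "real \<Rightarrow> real"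
  assumes "a \<le> b" and "\<mu> > 0"
    and d1: "\<And>x. x \<in> {a..b} \<Longrightarrow> (\<phi> has_real_derivative \<phi>' x) (at x within {a..b})"
    and d2: "\<And>x. x \<in> {a..b} \<Longrightarrow> (\<phi>' has_real_derivative \<phi>'' x) (at x within {a..b})"
    and ge: "(\<forall>x\<in>{a..b}. \<mu> \<le> \<phi>'' x) \<or> (\<forall>x\<in>{a..b}. \<mu> \<le> - \<phi>'' x)"
  shows "norm (integral {a..b} (\<lambda>x. cis (\<phi> x))) \<le> 6 / sqrt \<mu>"
  using ge
proof
  assume "\<forall>x\<in>{a..b}. \<mu> \<le> \<phi>'' x"
  then show ?thesis by (intro second_derivative_test[OF assms(1-4)]) auto
next
  assume *: "\<forall>x\<in>{a..b}. \<mu> \<le> - \<phi>'' x"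
  have "norm (integral {a..b} (\<lambda>x. cis (- \<phi> x))) \<le> 6 / sqrt \<mu>"
    using * by (intro second_derivative_test[OF assms(1,2), of _ "\<lambda>x. - \<phi>' x" "\<lambda>x. - \<phi>'' x"]
        DERIV_minus d1 d2) auto
  also have "integral {a..b} (\<lambda>x. cis (- \<phi> x)) = cnj (integral {a..b} (\<lambda>x. cis (\<phi> x)))"
    by (simp add: integral_cnj cis_cnj)
  finally show ?thesis by simp
qed

section \<open>Amplitudes with power growth against a degenerate phase\<close>

text \<open>
  The factor \<open>E\<close> enters only through its tails \<open>\<Phi> x = \<integral>\<^sub>x\<^sup>c E\<close>.  Since \<open>\<Phi>\<close> is an antiderivative of
  \<open>- E\<close>, integration by parts leaves two boundary terms \<open>\<Phi> u\<close> and the integral of \<open>\<Phi> u'\<close>, which is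
  bounded by \<open>K * U\<close> times the integral of \<open>x powr (s - 3/2)\<close>.  The hypothesis on \<open>s\<close> keeps this
  exponent away from the logarithmic case, so each of the three terms is at most \<open>K * U\<close> times the
  larger endpoint value of \<open>x powr (s - 1/2)\<close>.  The singular tail bound is what the second
  derivative test gives for a phase whose second derivative vanishes linearly at \<open>0\<close>; it takes the
  place of a dyadic decomposition.
\<close>

lemma weighted_oscillatory_bound:
  fixes E u u' :: "real \<Rightarrow> complex"
  assumes ab: "0 < \<alpha>" "\<alpha> \<le> \<beta>" "\<beta> \<le> c" and "0 \<le> K" "0 \<le> U"
    and E: "continuous_on {0..c} E"
    and tail: "\<And>x. 0 < x \<Longrightarrow> x \<le> c \<Longrightarrow> norm (integral {x..c} E) \<le> K / sqrt x"
    and du: "\<And>x. x \<in> {\<alpha>..\<beta>} \<Longrightarrow> (u has_vector_derivative u' x) (at x within {\<alpha>..\<beta>})"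
    and u: "\<And>x. x \<in> {\<alpha>..\<beta>} \<Longrightarrow> norm (u x) \<le> U * x powr s"
    and u': "\<And>x. x \<in> {\<alpha>..\<beta>} \<Longrightarrow> norm (u' x) \<le> U * x powr (s - 1)"
    and s: "1 \<le> \<bar>s - 1/2\<bar>"
  shows "norm (integral {\<alpha>..\<beta>} (\<lambda>x. E x * u x))
    \<le> 3 * K * U * max (\<alpha> powr (s - 1/2)) (\<beta> powr (s - 1/2))"
proof -
  define \<Phi> where "\<Phi> x = integral {x..c} E" for x
  define e where "e = s - 1/2"
  have half: "1 / sqrt x = x powr (-1/2)" if "x > 0" for x :: real
    using that powr_minus_divide[of x "1/2"] by (simp add: powr_half_sqrt)
  have tail': "norm (\<Phi> x) * (U * x powr y) \<le> K * U * x powr (y - 1/2)" if "0 < x" "x \<le> c" for x y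
  proof -
    have "norm (\<Phi> x) * (U * x powr y) \<le> K / sqrt x * (U * x powr y)"
      using tail[OF that] \<open>0 \<le> U\<close> by (intro mult_right_mono) (auto simp: \<Phi>_def)
    also have "\<dots> = K * U * (x powr y * (1 / sqrt x))" by simp
    also have "\<dots> = K * U * x powr (y - 1/2)"
      unfolding half[OF \<open>0 < x\<close>] by (simp flip: powr_add)
    finally show ?thesis .
  qed
  have intE: "E integrable_on {0..c}" by (rule integrable_continuous_real[OF E])
  have d\<Phi>: "(\<Phi> has_vector_derivative - E x) (at x within {\<alpha>..\<beta>})" if x: "x \<in> {\<alpha>..\<beta>}" for x
  proof -
    have "((\<lambda>x. integral {0..c} E - integral {0..x} E) has_vector_derivative 0 - E x)
        (at x within {0..c})"
      using x ab by (intro has_vector_derivative_diff has_vector_derivative_const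
          integral_has_vector_derivative E) auto
    moreover have "integral {0..c} E - integral {0..y} E = \<Phi> y" if "y \<in> {0..c}" for y
      using Henstock_Kurzweil_Integration.integral_combine[OF _ _ intE, of y] that
      by (auto simp: \<Phi>_def algebra_simps)
    ultimately have "(\<Phi> has_vector_derivative - E x) (at x within {0..c})"
      using x ab by (intro has_vector_derivative_transform[of x "{0..c}" \<Phi>]) auto
    then show ?thesis
      by (rule has_vector_derivative_within_subset) (use ab in auto)
  qed
  have "((\<lambda>x. \<Phi> x * u' x + - E x * u x) has_integral (\<Phi> \<beta> * u \<beta> - \<Phi> \<alpha> * u \<alpha>)) {\<alpha>..\<beta>}"
    by (intro fundamental_theorem_of_calculus ab has_vector_derivative_mult d\<Phi> du)
  moreover have "(\<lambda>x. E x * u x) integrable_on {\<alpha>..\<beta>}"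
  proof (intro integrable_continuous_real continuous_on_mult)
    show "continuous_on {\<alpha>..\<beta>} E" by (rule continuous_on_subset[OF E]) (use ab in auto)
    show "continuous_on {\<alpha>..\<beta>} u" by (rule continuous_on_vector_derivative[OF du])
  qed
  ultimately have parts: "((\<lambda>x. \<Phi> x * u' x) has_integral
      (\<Phi> \<beta> * u \<beta> - \<Phi> \<alpha> * u \<alpha> + integral {\<alpha>..\<beta>} (\<lambda>x. E x * u x))) {\<alpha>..\<beta>}"
    using has_integral_add[OF _ integrable_integral[of "\<lambda>x. E x * u x" "{\<alpha>..\<beta>}"],
        of "\<lambda>x. \<Phi> x * u' x + - E x * u x" "\<Phi> \<beta> * u \<beta> - \<Phi> \<alpha> * u \<alpha>"] by simp
  define m where "m = max (\<alpha> powr e) (\<beta> powr e)"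
  have e: "e \<noteq> 0" "1 \<le> \<bar>e\<bar>" using s by (auto simp: e_def)
  have pw: "((\<lambda>x. K * U * x powr (e - 1)) has_integral K * U * (\<beta> powr e / e - \<alpha> powr e / e)) {\<alpha>..\<beta>}"
  proof (intro has_integral_mult_right fundamental_theorem_of_calculus ab)
    show "((\<lambda>x. x powr e / e) has_vector_derivative x powr (e - 1)) (at x within {\<alpha>..\<beta>})"
      if "x \<in> {\<alpha>..\<beta>}" for x
      using that ab e
      by (auto intro!: derivative_eq_intros
          simp: powr_diff simp flip: has_real_derivative_iff_has_vector_derivative)
  qed
  have "norm (integral {\<alpha>..\<beta>} (\<lambda>x. \<Phi> x * u' x)) \<le> integral {\<alpha>..\<beta>} (\<lambda>x. K * U * x powr (e - 1))"
  proof (rule integral_norm_bound_integral)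
    show "norm (\<Phi> x * u' x) \<le> K * U * x powr (e - 1)" if "x \<in> {\<alpha>..\<beta>}" for x
    proof -
      have "norm (\<Phi> x * u' x) \<le> norm (\<Phi> x) * (U * x powr (s - 1))"
        unfolding norm_mult by (intro mult_left_mono u' that) auto
      also have "\<dots> \<le> K * U * x powr (s - 1 - 1/2)"
        using that ab by (intro tail') auto
      finally show ?thesis by (simp add: e_def)
    qed
  qed (use parts pw in auto)
  also have "\<dots> = K * U * ((\<beta> powr e - \<alpha> powr e) / e)"
    using integral_unique[OF pw] by (simp add: diff_divide_distrib)
  also have "\<dots> \<le> K * U * m"
  proof (intro mult_left_mono)
    have "\<bar>(\<beta> powr e - \<alpha> powr e) / e\<bar> \<le> \<bar>\<beta> powr e - \<alpha> powr e\<bar> / 1"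
      unfolding abs_divide using e by (intro divide_left_mono) auto
    also have "\<dots> \<le> m"
      using powr_ge_zero[of \<alpha> e] powr_ge_zero[of \<beta> e] by (auto simp: m_def max_def abs_if)
    finally show "(\<beta> powr e - \<alpha> powr e) / e \<le> m" by (rule order_trans[OF abs_ge_self])
  qed (use \<open>0 \<le> K\<close> \<open>0 \<le> U\<close> in auto)
  finally have remainder: "norm (integral {\<alpha>..\<beta>} (\<lambda>x. \<Phi> x * u' x)) \<le> K * U * m" .
  have boundary: "norm (\<Phi> x * u x) \<le> K * U * m" if "x = \<alpha> \<or> x = \<beta>" for x
  proof -
    have "norm (\<Phi> x * u x) \<le> norm (\<Phi> x) * (U * x powr s)"
      unfolding norm_mult using that ab by (intro mult_left_mono u) auto
    also have "\<dots> \<le> K * U * x powr e"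
      using that ab tail'[of x s] by (auto simp: e_def)
    also have "\<dots> \<le> K * U * m"
      using that \<open>0 \<le> K\<close> \<open>0 \<le> U\<close> by (intro mult_left_mono) (auto simp: m_def)
    finally show ?thesis .
  qed
  have "integral {\<alpha>..\<beta>} (\<lambda>x. E x * u x)
      = integral {\<alpha>..\<beta>} (\<lambda>x. \<Phi> x * u' x) - (\<Phi> \<beta> * u \<beta> - \<Phi> \<alpha> * u \<alpha>)"
    using integral_unique[OF parts] by simp
  also have "norm \<dots> \<le> norm (integral {\<alpha>..\<beta>} (\<lambda>x. \<Phi> x * u' x))
      + (norm (\<Phi> \<beta> * u \<beta>) + norm (\<Phi> \<alpha> * u \<alpha>))"
    by (intro norm_triangle_le_diff add_left_mono norm_triangle_ineq4)
  also have "\<dots> \<le> 3 * K * U * m"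
    using remainder boundary[of \<alpha>] boundary[of \<beta>] by simp
  finally show ?thesis by (simp add: m_def e_def)
qed

text \<open>
  On \<open>{x..c}\<close> the second derivative of the phase \<open>p * t\<close> is at least \<open>\<kappa> * \<bar>t\<bar> * x\<close> in
  absolute value, with a constant sign.
\<close>

lemma oscillatory_tail_bound:
  fixes p p' p'' :: "real \<Rightarrow> real"
  assumes "0 < \<kappa>" "t \<noteq> 0" "0 < x" "x \<le> c"
    and d1: "\<And>y. y \<in> {0..c} \<Longrightarrow> (p has_real_derivative p' y) (at y within {0..c})"
    and d2: "\<And>y. y \<in> {0..c} \<Longrightarrow> (p' has_real_derivative p'' y) (at y within {0..c})"
    and ge: "(\<forall>y\<in>{0..c}. \<kappa> * y \<le> p'' y) \<or> (\<forall>y\<in>{0..c}. \<kappa> * y \<le> - p'' y)"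
  shows "norm (integral {x..c} (\<lambda>y. cis (p y * t))) \<le> 6 / sqrt (\<kappa> * \<bar>t\<bar>) / sqrt x"
proof -
  have "norm (integral {x..c} (\<lambda>y. cis (p y * t))) \<le> 6 / sqrt (\<kappa> * \<bar>t\<bar> * x)"
  proof (rule second_derivative_test_abs)
    show "0 < \<kappa> * \<bar>t\<bar> * x" using assms by simp
    show "((\<lambda>y. p y * t) has_real_derivative p' y * t) (at y within {x..c})" if "y \<in> {x..c}" for y
      using that \<open>0 < x\<close> by (intro DERIV_cmult_right DERIV_subset[OF d1]) auto
    show "((\<lambda>y. p' y * t) has_real_derivative p'' y * t) (at y within {x..c})" if "y \<in> {x..c}" for y
      using that \<open>0 < x\<close> by (intro DERIV_cmult_right DERIV_subset[OF d2]) auto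
    have *: "\<kappa> * \<bar>t\<bar> * x \<le> \<bar>t\<bar> * d" if "\<kappa> * y \<le> d" "x \<le> y" for y d
    proof -
      have "\<kappa> * x \<le> \<kappa> * y" using that assms by simp
      then have "\<kappa> * x \<le> d" using that by linarith
      from mult_left_mono[OF this, of "\<bar>t\<bar>"] show ?thesis by (simp add: mult_ac)
    qed
    have "(\<forall>y\<in>{x..c}. \<kappa> * \<bar>t\<bar> * x \<le> \<bar>t\<bar> * p'' y) \<or> (\<forall>y\<in>{x..c}. \<kappa> * \<bar>t\<bar> * x \<le> \<bar>t\<bar> * - p'' y)"
      using ge
    proof
      assume "\<forall>y\<in>{0..c}. \<kappa> * y \<le> p'' y"
      then show ?thesis using *[of _ "p'' _"] \<open>0 < x\<close> by force
    next
      assume "\<forall>y\<in>{0..c}. \<kappa> * y \<le> - p'' y"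
      then show ?thesis using *[of _ "- p'' _"] \<open>0 < x\<close> by force
    qed
    then show "(\<forall>y\<in>{x..c}. \<kappa> * \<bar>t\<bar> * x \<le> p'' y * t) \<or> (\<forall>y\<in>{x..c}. \<kappa> * \<bar>t\<bar> * x \<le> - (p'' y * t))"
      by (cases "t > 0") (auto simp: mult.commute)
  qed (use assms in auto)
  then show ?thesis by (simp add: real_sqrt_mult)
qed

lemma norm_cis_minus_1_le: "norm (cis x - 1) \<le> \<bar>x\<bar>"
  using dist_exp_i_1[of x] abs_sin_x_le_abs_x[of "x / 2"] by (simp add: cis_conv_exp)

text \<open>
  This is \<open>weighted_oscillatory_bound\<close> with \<open>s = - 1\<close>: the exponent \<open>- 3/2\<close> is negative, so the
  inner endpoint dominates.
\<close>

lemma far_estimate: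
  fixes F F' :: "real \<Rightarrow> complex" and p p' :: "real \<Rightarrow> real"
  assumes "0 < r" "r \<le> c" "0 \<le> K" "0 \<le> A" "0 \<le> B"
    and p: "\<And>x. x \<in> {0..c} \<Longrightarrow> (p has_real_derivative p' x) (at x within {0..c})"
    and tail: "\<And>x. 0 < x \<Longrightarrow> x \<le> c \<Longrightarrow> norm (integral {x..c} (\<lambda>y. cis (p y * t))) \<le> K / sqrt x"
    and dF: "\<And>x. x \<in> {0..c} \<Longrightarrow> (F has_vector_derivative F' x) (at x within {0..c})"
    and F: "\<And>x. 0 < x \<Longrightarrow> x \<le> c \<Longrightarrow> norm (F x) * x \<le> A"
    and F': "\<And>x. 0 < x \<Longrightarrow> x \<le> c \<Longrightarrow> norm (F' x) * x\<^sup>2 \<le> B"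
  shows "norm (integral {r..c} (\<lambda>x. cis (p x * t) * F x)) \<le> 3 * K * (A + B) * r powr (-3/2)"
proof -
  have "norm (integral {r..c} (\<lambda>x. cis (p x * t) * F x))
      \<le> 3 * K * (A + B) * max (r powr (-1 - 1/2)) (c powr (-1 - 1/2))"
  proof (rule weighted_oscillatory_bound)
    show "continuous_on {0..c} (\<lambda>x. cis (p x * t))"
      by (rule continuous_on_cis_derivative[OF DERIV_cmult_right[OF p]])
    show "(F has_vector_derivative F' x) (at x within {r..c})" if "x \<in> {r..c}" for x
      using that \<open>0 < r\<close> by (intro has_vector_derivative_within_subset[OF dF]) auto
    show "norm (F x) \<le> (A + B) * x powr - 1" if "x \<in> {r..c}" for x
      using that F[of x] assms(1-5) by (auto simp: powr_minus field_simps)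
    show "norm (F' x) \<le> (A + B) * x powr (- 1 - 1)" if "x \<in> {r..c}" for x
    proof -
      have "x powr (- 1 - 1) = 1 / x\<^sup>2"
        using that \<open>0 < r\<close> by (simp add: powr_minus divide_inverse)
      moreover have "norm (F' x) * x\<^sup>2 \<le> A + B"
        using that F'[of x] assms(1-5) by simp
      ultimately show ?thesis
        using that \<open>0 < r\<close> by (simp add: pos_le_divide_eq)
    qed
  qed (use assms in auto)
  also have "max (r powr (-1 - 1/2)) (c powr (-1 - 1/2)) = r powr (-3/2)"
    using assms(1,2) powr_mono2'[of "-3/2" r c] by simp
  finally show ?thesis .
qed

text \<open>
  This is \<open>weighted_oscillatory_bound\<close> with \<open>s = q - 1\<close>, applied to \<open>cis (p\<^sub>0 * t)\<close> and the amplitude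
  \<open>F * (cis ((p - p\<^sub>0) * t) - 1)\<close>.  The closeness of the phases makes this amplitude vanish at \<open>0\<close>
  to the order \<open>q - 1\<close>, and the closeness of their derivatives makes its derivative vanish to the
  order \<open>q - 2\<close>.  Now the outer endpoint dominates, so the bound is uniform in the inner endpoint,
  which may tend to \<open>0\<close>.
\<close>

lemma near_estimate:
  fixes F F' :: "real \<Rightarrow> complex" and p p' p\<^sub>0 p\<^sub>0' :: "real \<Rightarrow> real"
  assumes "0 < r" "r \<le> c" "0 \<le> K" "0 \<le> A" "0 \<le> B" "0 \<le> M" "q > 3"
    and p: "\<And>x. x \<in> {0..c} \<Longrightarrow> (p has_real_derivative p' x) (at x within {0..c})"
    and p0: "\<And>x. x \<in> {0..c} \<Longrightarrow> (p\<^sub>0 has_real_derivative p\<^sub>0' x) (at x within {0..c})"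
    and close: "\<And>x. 0 < x \<Longrightarrow> x \<le> c \<Longrightarrow> \<bar>p x - p\<^sub>0 x\<bar> \<le> M * x powr q"
    and close': "\<And>x. 0 < x \<Longrightarrow> x \<le> c \<Longrightarrow> \<bar>p' x - p\<^sub>0' x\<bar> \<le> M * x powr (q - 1)"
    and tail: "\<And>x. 0 < x \<Longrightarrow> x \<le> c \<Longrightarrow> norm (integral {x..c} (\<lambda>y. cis (p\<^sub>0 y * t))) \<le> K / sqrt x"
    and dF: "\<And>x. x \<in> {0..c} \<Longrightarrow> (F has_vector_derivative F' x) (at x within {0..c})"
    and F: "\<And>x. 0 < x \<Longrightarrow> x \<le> c \<Longrightarrow> norm (F x) * x \<le> A"
    and F': "\<And>x. 0 < x \<Longrightarrow> x \<le> c \<Longrightarrow> norm (F' x) * x\<^sup>2 \<le> B"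
  shows "norm (integral {0..r} (\<lambda>x. (cis (p x * t) - cis (p\<^sub>0 x * t)) * F x))
    \<le> 3 * K * ((A + B) * \<bar>t\<bar> * M) * r powr (q - 3/2)"
proof -
  define f where "f x = (cis (p x * t) - cis (p\<^sub>0 x * t)) * F x" for x
  define k where "k x = cis ((p x - p\<^sub>0 x) * t) - 1" for x
  define k' where "k' x = of_real ((p' x - p\<^sub>0' x) * t) * (\<i> * cis ((p x - p\<^sub>0 x) * t))" for x
  define X where "X = 3 * K * ((A + B) * \<bar>t\<bar> * M) * r powr (q - 3/2)"
  have f_eq: "f x = cis (p\<^sub>0 x * t) * (F x * k x)" for x
    by (simp add: f_def k_def algebra_simps cis_mult)
  have dk: "(k has_vector_derivative k' x) (at x within {0..c})" if "x \<in> {0..c}" for x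
    using has_vector_derivative_diff[OF has_vector_derivative_cis[OF
        DERIV_cmult_right[OF DERIV_diff[OF p[OF that] p0[OF that]]]] has_vector_derivative_const]
    by (simp add: k_def[abs_def] k'_def)
  have away: "norm (integral {\<alpha>..r} f) \<le> X" if \<alpha>: "0 < \<alpha>" "\<alpha> \<le> r" for \<alpha>
  proof -
    have "norm (integral {\<alpha>..r} (\<lambda>x. cis (p\<^sub>0 x * t) * (F x * k x)))
      \<le> 3 * K * ((A + B) * \<bar>t\<bar> * M) * max (\<alpha> powr (q - 1 - 1/2)) (r powr (q - 1 - 1/2))"
    proof (rule weighted_oscillatory_bound)
      show "continuous_on {0..c} (\<lambda>x. cis (p\<^sub>0 x * t))"
        by (rule continuous_on_cis_derivative[OF DERIV_cmult_right[OF p0]])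
      fix x assume x: "x \<in> {\<alpha>..r}"
      then have x0: "0 < x" "x \<le> c" using \<alpha> assms(2) by auto
      show "((\<lambda>x. F x * k x) has_vector_derivative F x * k' x + F' x * k x) (at x within {\<alpha>..r})"
        using x \<alpha> assms(2)
        by (intro has_vector_derivative_within_subset[OF has_vector_derivative_mult[OF dF dk]]) auto
      have kx: "norm (k x) \<le> \<bar>t\<bar> * M * x powr q"
      proof -
        have "norm (k x) \<le> \<bar>p x - p\<^sub>0 x\<bar> * \<bar>t\<bar>"
          unfolding k_def using norm_cis_minus_1_le by (simp flip: abs_mult)
        also have "\<dots> \<le> M * x powr q * \<bar>t\<bar>"
          by (intro mult_right_mono close x0) auto
        finally show ?thesis by (simp add: mult_ac)
      qed
      have k'x: "norm (k' x) \<le> \<bar>t\<bar> * M * x powr (q - 1)"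
      proof -
        have "norm (k' x) = \<bar>p' x - p\<^sub>0' x\<bar> * \<bar>t\<bar>"
          unfolding k'_def norm_mult norm_of_real by (simp add: abs_mult)
        also have "\<dots> \<le> M * x powr (q - 1) * \<bar>t\<bar>"
          by (intro mult_right_mono close' x0) auto
        finally show ?thesis by (simp add: mult_ac)
      qed
      have pq: "x powr q = x * x powr (q - 1)" "x powr (q - 1) = x * x powr (q - 2)"
        using x0 by (auto simp: powr_diff power2_eq_square)
      have "norm (F x * k x) \<le> norm (F x) * (\<bar>t\<bar> * M * x powr q)"
        unfolding norm_mult by (intro mult_left_mono kx) auto
      also have "\<dots> = norm (F x) * x * (\<bar>t\<bar> * M * x powr (q - 1))" by (simp add: pq(1))
      also have "\<dots> \<le> (A + B) * (\<bar>t\<bar> * M * x powr (q - 1))"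
        using F[OF x0] assms by (intro mult_right_mono) auto
      finally show "norm (F x * k x) \<le> (A + B) * \<bar>t\<bar> * M * x powr (q - 1)" by (simp add: mult_ac)
      have "norm (F x * k' x + F' x * k x)
          \<le> norm (F x) * (\<bar>t\<bar> * M * x powr (q - 1)) + norm (F' x) * (\<bar>t\<bar> * M * x powr q)"
        by (intro norm_triangle_le add_mono) (auto simp: norm_mult intro!: mult_left_mono kx k'x)
      also have "\<dots> = (norm (F x) * x + norm (F' x) * x\<^sup>2) * (\<bar>t\<bar> * M * x powr (q - 2))"
        by (simp add: pq power2_eq_square algebra_simps)
      also have "\<dots> \<le> (A + B) * (\<bar>t\<bar> * M * x powr (q - 2))"
        using F[OF x0] F'[OF x0] assms by (intro mult_right_mono) auto
      finally show "norm (F x * k' x + F' x * k x) \<le> (A + B) * \<bar>t\<bar> * M * x powr (q - 1 - 1)"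
        by (simp add: mult_ac)
    qed (use \<alpha> assms in auto)
    also have "max (\<alpha> powr (q - 1 - 1/2)) (r powr (q - 1 - 1/2)) = r powr (q - 3/2)"
      using \<alpha> \<open>q > 3\<close> powr_mono2[of "q - 3/2" \<alpha> r] by (simp add: max_def)
    finally show ?thesis by (simp add: f_eq[abs_def] X_def)
  qed
  have "continuous_on {0..c} f"
    unfolding f_def
    by (intro continuous_intros continuous_on_real_derivative[OF p]
        continuous_on_real_derivative[OF p0] continuous_on_vector_derivative[OF dF])
  then have "f integrable_on {0..r}"
    using assms(2) by (intro integrable_continuous_real) (auto intro: continuous_on_subset)
  then have "continuous_on {0..r} (\<lambda>x. integral {x..r} f)"
    by (rule indefinite_integral_continuous_1')
  then have lim: "((\<lambda>x. integral {x..r} f) \<longlongrightarrow> integral {0..r} f) (at_right 0)"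
    using continuous_on_Icc_at_rightD[of 0 r "\<lambda>x. integral {x..r} f"] \<open>0 < r\<close> by blast
  have "norm (integral {0..r} f) \<le> X"
    using eventually_at_right_less[of "0::real"] eventually_at_right_field
    by (intro Lim_norm_ubound[OF _ lim])
       (use \<open>0 < r\<close> away in \<open>auto simp: eventually_at_right_field intro!: exI[of _ r]\<close>)
  then show ?thesis by (simp add: f_def[abs_def] X_def)
qed

section \<open>The estimate on one side of the degenerate point\<close>

text \<open>
  By the intermediate value theorem \<open>h'\<close> cannot change sign.  Applied to the second derivative of a
  phase, this gives the linear lower bound for the second derivative test.
\<close>

lemma monotone_from_zero:
  fixes h h' :: "real \<Rightarrow> real"
  assumes "0 \<le> c" "0 \<le> \<kappa>" and "h 0 = 0"
    and dh: "\<And>x. x \<in> {0..c} \<Longrightarrow> (h has_real_derivative h' x) (at x within {0..c})"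
    and cont: "continuous_on {0..c} h'"
    and large: "\<And>x. x \<in> {0..c} \<Longrightarrow> \<kappa> < \<bar>h' x\<bar>"
  shows "(\<forall>y\<in>{0..c}. \<kappa> * y \<le> h y) \<or> (\<forall>y\<in>{0..c}. \<kappa> * y \<le> - h y)"
proof -
  have lower: "\<kappa> * y \<le> g y"
    if "\<And>x. x \<in> {0..c} \<Longrightarrow> (g has_real_derivative g' x) (at x within {0..c})"
      "\<And>x. x \<in> {0..c} \<Longrightarrow> \<kappa> \<le> g' x" "g 0 = 0" "y \<in> {0..c}" for g g' :: "real \<Rightarrow> real" and y
  proof -
    have "\<kappa> * (y - 0) \<le> g y - g 0"
      using that by (intro increment_ge[of _ _ _ g'] DERIV_subset[OF that(1)]) auto
    then show ?thesis using that by simp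
  qed
  have "is_interval (h' ` {0..c})"
    using connected_continuous_image[OF cont] is_interval_connected_1 by simp
  moreover have "0 \<notin> h' ` {0..c}" using large \<open>0 \<le> \<kappa>\<close> by force
  ultimately have "(\<forall>x\<in>{0..c}. 0 \<le> h' x) \<or> (\<forall>x\<in>{0..c}. h' x \<le> 0)"
    unfolding is_interval_1 by (meson image_eqI linorder_le_cases)
  then show ?thesis
  proof
    assume "\<forall>x\<in>{0..c}. 0 \<le> h' x"
    then have "\<kappa> \<le> h' x" if "x \<in> {0..c}" for x using large[OF that] that by fastforce
    then show ?thesis using lower[OF dh] \<open>h 0 = 0\<close> by blast
  next
    assume "\<forall>x\<in>{0..c}. h' x \<le> 0"
    then have "\<kappa> \<le> - h' x" if "x \<in> {0..c}" for x using large[OF that] that by fastforce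
    then show ?thesis using lower[OF DERIV_minus[OF dh]] \<open>h 0 = 0\<close> by simp
  qed
qed

text \<open>
  The interval is cut at \<open>\<rho> = \<bar>t\<bar> powr (- 1/q)\<close>, where the near and the far estimate give the same
  power of \<open>\<bar>t\<bar>\<close>.  The near part contributes \<open>M\<close> and each exponential in the far part contributes
  \<open>1\<close> to the factor \<open>M + 2\<close>.
\<close>

lemma half_interval_estimate:
  fixes F F' :: "real \<Rightarrow> complex" and p p\<^sub>0 p' p\<^sub>0' p'' p\<^sub>0'' :: "real \<Rightarrow> real"
  assumes "0 \<le> c" "0 < \<kappa>" "0 \<le> A" "0 \<le> B" "0 \<le> M" "q > 3" "t \<noteq> 0"
    and p: "\<And>x. x \<in> {0..c} \<Longrightarrow> (p has_real_derivative p' x) (at x within {0..c})"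
    and p': "\<And>x. x \<in> {0..c} \<Longrightarrow> (p' has_real_derivative p'' x) (at x within {0..c})"
    and p'': "(\<forall>x\<in>{0..c}. \<kappa> * x \<le> p'' x) \<or> (\<forall>x\<in>{0..c}. \<kappa> * x \<le> - p'' x)"
    and p0: "\<And>x. x \<in> {0..c} \<Longrightarrow> (p\<^sub>0 has_real_derivative p\<^sub>0' x) (at x within {0..c})"
    and p0': "\<And>x. x \<in> {0..c} \<Longrightarrow> (p\<^sub>0' has_real_derivative p\<^sub>0'' x) (at x within {0..c})"
    and p0'': "(\<forall>x\<in>{0..c}. \<kappa> * x \<le> p\<^sub>0'' x) \<or> (\<forall>x\<in>{0..c}. \<kappa> * x \<le> - p\<^sub>0'' x)"
    and close: "\<And>x. 0 < x \<Longrightarrow> x \<le> c \<Longrightarrow> \<bar>p x - p\<^sub>0 x\<bar> \<le> M * x powr q"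
    and close': "\<And>x. 0 < x \<Longrightarrow> x \<le> c \<Longrightarrow> \<bar>p' x - p\<^sub>0' x\<bar> \<le> M * x powr (q - 1)"
    and dF: "\<And>x. x \<in> {0..c} \<Longrightarrow> (F has_vector_derivative F' x) (at x within {0..c})"
    and F: "\<And>x. 0 < x \<Longrightarrow> x \<le> c \<Longrightarrow> norm (F x) * x \<le> A"
    and F': "\<And>x. 0 < x \<Longrightarrow> x \<le> c \<Longrightarrow> norm (F' x) * x\<^sup>2 \<le> B"
  shows "norm (integral {0..c} (\<lambda>x. (cis (p x * t) - cis (p\<^sub>0 x * t)) * F x))
    \<le> 18 * (M + 2) / sqrt \<kappa> / \<bar>t\<bar> powr ((q - 3) / (2 * q)) * (A + B)"
proof (cases "c = 0")
  case True
  then show ?thesis using assms by simp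
next
  case False
  define f where "f x = (cis (p x * t) - cis (p\<^sub>0 x * t)) * F x" for x
  define T where "T = \<bar>t\<bar>"
  define K where "K = 6 / sqrt (\<kappa> * T)"
  define \<rho> where "\<rho> = T powr (- 1 / q)"
  \<comment> \<open>If the interval ends before \<open>\<rho>\<close>, then \<open>r = c\<close> and there is no far part.\<close>
  define r where "r = min c \<rho>"
  define D where "D = T powr (- ((q - 3) / (2 * q)))"
  have T: "T > 0" using \<open>t \<noteq> 0\<close> by (simp add: T_def)
  then have \<rho>: "\<rho> > 0" by (simp add: \<rho>_def)
  have r: "0 < r" "r \<le> c" "r \<le> \<rho>" using False \<open>0 \<le> c\<close> \<rho> by (auto simp: r_def)
  have K0: "0 \<le> K" using T \<open>0 < \<kappa>\<close> by (simp add: K_def)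
  have K: "K = 6 / sqrt \<kappa> * T powr (- 1/2)"
    using T powr_minus_divide[of T "1/2"] by (simp add: K_def powr_half_sqrt real_sqrt_mult)
  have tail: "norm (integral {x..c} (\<lambda>y. cis (p y * t))) \<le> K / sqrt x"
    if "0 < x" "x \<le> c" for x
    unfolding K_def T_def by (rule oscillatory_tail_bound[OF assms(2,7) that p p' p''])
  have tail0: "norm (integral {x..c} (\<lambda>y. cis (p\<^sub>0 y * t))) \<le> K / sqrt x"
    if "0 < x" "x \<le> c" for x
    unfolding K_def T_def by (rule oscillatory_tail_bound[OF assms(2,7) that p0 p0' p0''])
  have near: "norm (integral {0..r} f) \<le> 18 / sqrt \<kappa> * M * D * (A + B)"
  proof -
    have "norm (integral {0..r} f) \<le> 3 * K * ((A + B) * T * M) * r powr (q - 3/2)"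
      unfolding f_def T_def
      using near_estimate[OF r(1,2) K0 assms(3-6) p p0 close close' tail0 dF F F'] .
    also have "\<dots> \<le> 3 * K * ((A + B) * T * M) * \<rho> powr (q - 3/2)"
      using r K0 T assms by (intro mult_left_mono powr_mono2) auto
    also have "\<dots> = 18 / sqrt \<kappa> * M * (A + B)
        * (T powr (- 1/2) * T powr 1 * \<rho> powr (q - 3/2))"
      using T by (simp add: K)
    \<comment> \<open>The exponents add up: \<open>1/2 - (q - 3/2) / q = - (q - 3) / (2 q)\<close>.\<close>
    also have "T powr (- 1/2) * T powr 1 * \<rho> powr (q - 3/2) = D"
      unfolding \<rho>_def D_def powr_powr powr_add[symmetric]
      using \<open>q > 3\<close> by (intro arg_cong[of _ _ "\<lambda>e. T powr e"]) (simp add: field_simps)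
    finally show ?thesis by (simp add: mult_ac)
  qed
  have far_bound: "3 * K * (A + B) * r powr (- 3/2) \<le> 18 / sqrt \<kappa> * D * (A + B)" if "r = \<rho>"
  proof -
    have "3 * K * (A + B) * r powr (- 3/2)
        = 18 / sqrt \<kappa> * (A + B) * (T powr (- 1/2) * \<rho> powr (- 3/2))"
      by (simp add: K that)
    \<comment> \<open>The exponents add up: \<open>- 1/2 + 3 / (2 q) = - (q - 3) / (2 q)\<close>.\<close>
    also have "T powr (- 1/2) * \<rho> powr (- 3/2) = D"
      unfolding \<rho>_def D_def powr_powr powr_add[symmetric]
      using \<open>q > 3\<close> by (intro arg_cong[of _ _ "\<lambda>e. T powr e"]) (simp add: field_simps)
    finally show ?thesis by (simp add: mult_ac)
  qed
  have far: "norm (integral {r..c} f) \<le> 2 * (18 / sqrt \<kappa> * D * (A + B))"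
  proof (cases "c \<le> \<rho>")
    case True
    then show ?thesis using assms by (simp add: r_def D_def)
  next
    case False
    then have "r = \<rho>" by (simp add: r_def)
    have E: "(\<lambda>x. cis (g x * t) * F x) integrable_on {r..c}"
      if g: "\<And>x. x \<in> {0..c} \<Longrightarrow> (g has_real_derivative g' x) (at x within {0..c})" for g g'
    proof -
      have "continuous_on {0..c} (\<lambda>x. cis (g x * t) * F x)"
        by (intro continuous_intros continuous_on_real_derivative[OF g]
            continuous_on_vector_derivative[OF dF])
      then show ?thesis
        using r by (intro integrable_continuous_real) (auto intro: continuous_on_subset)
    qed
    have "integral {r..c} f
        = integral {r..c} (\<lambda>x. cis (p x * t) * F x) - integral {r..c} (\<lambda>x. cis (p\<^sub>0 x * t) * F x)"
      unfolding f_def left_diff_distrib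
      using E[OF p] E[OF p0] by (rule Henstock_Kurzweil_Integration.integral_diff)
    also have "norm \<dots> \<le> norm (integral {r..c} (\<lambda>x. cis (p x * t) * F x))
        + norm (integral {r..c} (\<lambda>x. cis (p\<^sub>0 x * t) * F x))"
      by (rule norm_triangle_ineq4)
    also have "\<dots> \<le> 2 * (3 * K * (A + B) * r powr (- 3/2))"
      using far_estimate[OF r(1,2) K0 assms(3,4) p tail dF F F']
        far_estimate[OF r(1,2) K0 assms(3,4) p0 tail0 dF F F'] by linarith
    finally show ?thesis using far_bound[OF \<open>r = \<rho>\<close>] by simp
  qed
  have "continuous_on {0..c} f"
    unfolding f_def
    by (intro continuous_intros continuous_on_real_derivative[OF p]
        continuous_on_real_derivative[OF p0] continuous_on_vector_derivative[OF dF])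
  then have split: "integral {0..c} f = integral {0..r} f + integral {r..c} f"
    using r by (intro Henstock_Kurzweil_Integration.integral_combine[symmetric]
        integrable_continuous_real) auto
  have "norm (integral {0..c} f)
      \<le> 18 / sqrt \<kappa> * M * D * (A + B) + 2 * (18 / sqrt \<kappa> * D * (A + B))"
    unfolding split by (rule order_trans[OF norm_triangle_ineq add_mono[OF near far]])
  also have "\<dots> = 18 * (M + 2) / sqrt \<kappa> * D * (A + B)"
    by (simp add: algebra_simps add_divide_distrib)
  also have "D = 1 / T powr ((q - 3) / (2 * q))"
    unfolding D_def by (rule powr_minus_divide)
  finally show ?thesis by (simp add: f_def[abs_def] T_def)
qed

section \<open>Smooth functions on an interval and the two sides of a point\<close>

lemma smooth_on_interval_derivative:
  assumes "smooth_on_interval I f" "x \<in> I"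
  shows "(nth_deriv_on I n f has_vector_derivative nth_deriv_on I (Suc n) f x) (at x within I)"
  using assms by (simp add: smooth_on_interval_def flip: vector_derivative_works)

lemma has_vector_derivative_affine:
  fixes f :: "real \<Rightarrow> 'a::real_normed_vector"
  assumes "(f has_vector_derivative f') (at (\<xi> + \<sigma> * x) within I)"
    and "\<And>x. x \<in> S \<Longrightarrow> \<xi> + \<sigma> * x \<in> I"
  shows "((\<lambda>x. f (\<xi> + \<sigma> * x)) has_vector_derivative \<sigma> *\<^sub>R f') (at x within S)"
proof -
  have "((\<lambda>x. \<xi> + \<sigma> * x) has_vector_derivative \<sigma>) (at x within S)"
    by (auto intro!: derivative_eq_intros simp flip: has_real_derivative_iff_has_vector_derivative)
  moreover have "(f has_vector_derivative f') (at (\<xi> + \<sigma> * x) within (\<lambda>x. \<xi> + \<sigma> * x) ` S)"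
    by (rule has_vector_derivative_within_subset[OF assms(1)]) (use assms(2) in auto)
  ultimately show ?thesis
    using vector_diff_chain_within by (fastforce simp: o_def)
qed

text \<open>
  The variable \<open>\<sigma> = 1\<close> or \<open>\<sigma> = - 1\<close> selects the side of \<open>\<xi>\<close>.  Every derivative in the variable
  \<open>x\<close> costs a factor \<open>\<sigma>\<close>, which changes no absolute value.
\<close>

lemma smooth_phase_half_interval:
  fixes \<omega> :: "real \<Rightarrow> real"
  assumes \<sigma>: "\<bar>\<sigma>\<bar> = 1" and "0 \<le> c" "0 \<le> \<kappa>"
    and sub: "\<And>x. x \<in> {0..c} \<Longrightarrow> \<xi> + \<sigma> * x \<in> I"
    and smooth: "smooth_on_interval I \<omega>"
    and third: "\<And>x. x \<in> I \<Longrightarrow> \<kappa> < \<bar>nth_deriv_on I 3 \<omega> x\<bar>"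
    and second: "nth_deriv_on I 2 \<omega> \<xi> = 0"
  shows "\<And>n x. x \<in> {0..c} \<Longrightarrow> ((\<lambda>x. \<sigma> ^ n * nth_deriv_on I n \<omega> (\<xi> + \<sigma> * x))
      has_real_derivative \<sigma> ^ Suc n * nth_deriv_on I (Suc n) \<omega> (\<xi> + \<sigma> * x)) (at x within {0..c})"
    and "(\<forall>x\<in>{0..c}. \<kappa> * x \<le> \<sigma> ^ 2 * nth_deriv_on I 2 \<omega> (\<xi> + \<sigma> * x)) \<or>
      (\<forall>x\<in>{0..c}. \<kappa> * x \<le> - (\<sigma> ^ 2 * nth_deriv_on I 2 \<omega> (\<xi> + \<sigma> * x)))"
proof -
  show d: "((\<lambda>x. \<sigma> ^ n * nth_deriv_on I n \<omega> (\<xi> + \<sigma> * x))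
      has_real_derivative \<sigma> ^ Suc n * nth_deriv_on I (Suc n) \<omega> (\<xi> + \<sigma> * x)) (at x within {0..c})"
    if "x \<in> {0..c}" for n x
  proof -
    have "((\<lambda>x. nth_deriv_on I n \<omega> (\<xi> + \<sigma> * x)) has_real_derivative
        \<sigma> * nth_deriv_on I (Suc n) \<omega> (\<xi> + \<sigma> * x)) (at x within {0..c})"
      using has_vector_derivative_affine[OF smooth_on_interval_derivative[OF smooth sub[OF that]] sub]
      by (simp only: has_real_derivative_iff_has_vector_derivative real_scaleR_def)
    from DERIV_cmult[OF this, of "\<sigma> ^ n"] show ?thesis
      by (simp only: power_Suc mult_ac)
  qed
  show "(\<forall>x\<in>{0..c}. \<kappa> * x \<le> \<sigma> ^ 2 * nth_deriv_on I 2 \<omega> (\<xi> + \<sigma> * x)) \<or>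
      (\<forall>x\<in>{0..c}. \<kappa> * x \<le> - (\<sigma> ^ 2 * nth_deriv_on I 2 \<omega> (\<xi> + \<sigma> * x)))"
  proof (rule monotone_from_zero[OF \<open>0 \<le> c\<close> \<open>0 \<le> \<kappa>\<close>])
    show "\<sigma>\<^sup>2 * nth_deriv_on I 2 \<omega> (\<xi> + \<sigma> * 0) = 0" using second by simp
    show "((\<lambda>x. \<sigma>\<^sup>2 * nth_deriv_on I 2 \<omega> (\<xi> + \<sigma> * x)) has_real_derivative
        \<sigma> ^ 3 * nth_deriv_on I 3 \<omega> (\<xi> + \<sigma> * x)) (at x within {0..c})" if "x \<in> {0..c}" for x
      using d[OF that, of 2] by (simp only: Suc_numeral add_num_simps flip: numeral_3_eq_3)
    show "continuous_on {0..c} (\<lambda>x. \<sigma> ^ 3 * nth_deriv_on I 3 \<omega> (\<xi> + \<sigma> * x))"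
      by (rule continuous_on_real_derivative[OF d])
    show "\<kappa> < \<bar>\<sigma> ^ 3 * nth_deriv_on I 3 \<omega> (\<xi> + \<sigma> * x)\<bar>" if "x \<in> {0..c}" for x
      using third[OF sub[OF that]] \<sigma> by (simp add: abs_mult power_abs)
  qed
qed

lemma le_powr_of_powi_bound:
  fixes q :: int
  assumes "X * d powi (- q + int l) \<le> M" "d > 0"
  shows "X \<le> M * d powr (of_int q - real l)"
proof -
  have "d powi (- q + int l) = d powr (- (of_int q - real l))"
    using powr_real_of_int'[of d "- q + int l"] assms(2) by simp
  also have "\<dots> = 1 / d powr (of_int q - real l)" by (rule powr_minus_divide)
  finally have "X / d powr (of_int q - real l) \<le> M" using assms(1) by simp
  then show ?thesis using assms(2) by (simp add: pos_divide_le_eq)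
qed

text \<open>
  The factors \<open>- 1\<close> and \<open>1\<close> are written out because both halves are instances of one estimate along
  \<open>\<xi> + \<sigma> * x\<close>.
\<close>

lemma integral_split_reflect:
  fixes f :: "real \<Rightarrow> 'a::euclidean_space"
  assumes "a \<le> \<xi>" "\<xi> \<le> b" "f integrable_on {a..b}"
  shows "integral {a..b} f
    = integral {0..\<xi> - a} (\<lambda>x. f (\<xi> + - 1 * x)) + integral {0..b - \<xi>} (\<lambda>x. f (\<xi> + 1 * x))"
proof -
  have "integral {0..\<xi> - a} (\<lambda>x. f (\<xi> - x)) = integral {- (\<xi> - a).. - 0} (\<lambda>x. f (x + \<xi>))"
    using Henstock_Kurzweil_Integration.integral_reflect_real[of "\<xi> - a" 0 "\<lambda>x. f (\<xi> - x)"]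
    by (simp add: add.commute)
  also have "\<dots> = integral {a..\<xi>} f"
    using integral_shift_real_ivl[of a \<xi> \<xi> f] by simp
  finally have 1: "integral {0..\<xi> - a} (\<lambda>x. f (\<xi> - x)) = integral {a..\<xi>} f" .
  have 2: "integral {0..b - \<xi>} (\<lambda>x. f (\<xi> + x)) = integral {\<xi>..b} f"
    using integral_shift_real_ivl[of \<xi> \<xi> b f] by (simp add: add.commute)
  show ?thesis
    using Henstock_Kurzweil_Integration.integral_combine[OF assms] by (simp add: 1 2)
qed

theorem lemma4p5:
  fixes q :: int and \<kappa> M :: real
  assumes "odd q" and "q > 3" and "\<kappa> > 0" and "M \<ge> 0"
  shows "\<exists>\<epsilon>\<^sub>0>0. \<exists>C>0.
    \<forall>(a::real) (b::real) (\<omega>::real \<Rightarrow> real) (\<omega>\<^sub>0::real \<Rightarrow> real) (F::real \<Rightarrow> complex) (\<xi>\<^sub>s::real).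
      (let I = {a..b};
           G = (\<lambda>\<xi>. F \<xi> * of_real \<bar>\<xi> - \<xi>\<^sub>s\<bar>);
           H = (\<lambda>\<xi>. nth_deriv_on I 1 F \<xi> * of_real (\<bar>\<xi> - \<xi>\<^sub>s\<bar> ^ 2))
       in a < b \<longrightarrow>
          smooth_on_interval I \<omega> \<longrightarrow> smooth_on_interval I \<omega>\<^sub>0 \<longrightarrow> smooth_on_interval I F \<longrightarrow>
          (\<forall>\<xi>\<in>I. \<kappa> < \<bar>nth_deriv_on I 3 \<omega> \<xi>\<bar> \<and> \<bar>nth_deriv_on I 3 \<omega> \<xi>\<bar> < M) \<longrightarrow>
          (\<forall>\<xi>\<in>I. \<kappa> < \<bar>nth_deriv_on I 3 \<omega>\<^sub>0 \<xi>\<bar> \<and> \<bar>nth_deriv_on I 3 \<omega>\<^sub>0 \<xi>\<bar> < M) \<longrightarrow>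
          \<xi>\<^sub>s \<in> I \<longrightarrow> \<bar>nth_deriv_on I 2 \<omega> \<xi>\<^sub>s\<bar> = 0 \<longrightarrow> \<bar>nth_deriv_on I 2 \<omega>\<^sub>0 \<xi>\<^sub>s\<bar> = 0 \<longrightarrow>
          I \<subseteq> {\<xi>\<^sub>s - \<epsilon>\<^sub>0..\<xi>\<^sub>s + \<epsilon>\<^sub>0} \<longrightarrow>
          bounded (G ` I) \<longrightarrow> bounded (H ` I) \<longrightarrow>
          (\<forall>l\<le>2. \<forall>\<xi>\<in>I - {\<xi>\<^sub>s}.
             \<bar>nth_deriv_on I l \<omega> \<xi> - nth_deriv_on I l \<omega>\<^sub>0 \<xi>\<bar> * \<bar>\<xi> - \<xi>\<^sub>s\<bar> powi (- q + int l) \<le> M) \<longrightarrow>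
          (\<forall>t::real. \<bar>t\<bar> \<ge> 1 \<longrightarrow>
             norm (integral I (\<lambda>\<xi>. (exp (\<i> * of_real (\<omega> \<xi> * t)) - exp (\<i> * of_real (\<omega>\<^sub>0 \<xi> * t))) * F \<xi>))
             \<le> C / \<bar>t\<bar> powr ((of_int q - 3) / (2 * of_int q))
                * ((SUP \<xi>\<in>I. norm (G \<xi>)) + (SUP \<xi>\<in>I. norm (H \<xi>)))))"
proof -
  \<comment> \<open>This is the constant for one side of \<open>\<xi>\<^sub>s\<close>; the two sides together give \<open>2 * C\<close>.\<close>
  define C where "C = 18 * (M + 2) / sqrt \<kappa>"
  have main: "norm (integral {a..b} (\<lambda>\<xi>. (exp (\<i> * of_real (\<omega> \<xi> * t)) - exp (\<i> * of_real (\<omega>\<^sub>0 \<xi> * t))) * F \<xi>))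
      \<le> (2 * C) / \<bar>t\<bar> powr ((of_int q - 3) / (2 * of_int q))
          * ((SUP \<xi>\<in>{a..b}. norm (F \<xi> * of_real \<bar>\<xi> - \<xi>\<^sub>s\<bar>))
            + (SUP \<xi>\<in>{a..b}. norm (nth_deriv_on {a..b} 1 F \<xi> * of_real (\<bar>\<xi> - \<xi>\<^sub>s\<bar> ^ 2))))"
    if smooth: "smooth_on_interval {a..b} \<omega>" "smooth_on_interval {a..b} \<omega>\<^sub>0"
        "smooth_on_interval {a..b} F"
      and third: "\<forall>\<xi>\<in>{a..b}. \<kappa> < \<bar>nth_deriv_on {a..b} 3 \<omega> \<xi>\<bar>"
        "\<forall>\<xi>\<in>{a..b}. \<kappa> < \<bar>nth_deriv_on {a..b} 3 \<omega>\<^sub>0 \<xi>\<bar>"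
      and \<xi>: "\<xi>\<^sub>s \<in> {a..b}"
      and second: "nth_deriv_on {a..b} 2 \<omega> \<xi>\<^sub>s = 0" "nth_deriv_on {a..b} 2 \<omega>\<^sub>0 \<xi>\<^sub>s = 0"
      and bounded: "bounded ((\<lambda>\<xi>. F \<xi> * of_real \<bar>\<xi> - \<xi>\<^sub>s\<bar>) ` {a..b})"
        "bounded ((\<lambda>\<xi>. nth_deriv_on {a..b} 1 F \<xi> * of_real (\<bar>\<xi> - \<xi>\<^sub>s\<bar> ^ 2)) ` {a..b})"
      and close: "\<forall>l\<le>2. \<forall>\<xi>\<in>{a..b} - {\<xi>\<^sub>s}. \<bar>nth_deriv_on {a..b} l \<omega> \<xi>
        - nth_deriv_on {a..b} l \<omega>\<^sub>0 \<xi>\<bar> * \<bar>\<xi> - \<xi>\<^sub>s\<bar> powi (- q + int l) \<le> M"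
      and t: "\<bar>t\<bar> \<ge> 1"
    for a b t \<xi>\<^sub>s :: real and \<omega> \<omega>\<^sub>0 :: "real \<Rightarrow> real" and F :: "real \<Rightarrow> complex"
  proof -
    define I where "I = {a..b}"
    define A where "A = (SUP \<xi>\<in>I. norm (F \<xi> * of_real \<bar>\<xi> - \<xi>\<^sub>s\<bar>))"
    define B where "B = (SUP \<xi>\<in>I. norm (nth_deriv_on I 1 F \<xi> * of_real (\<bar>\<xi> - \<xi>\<^sub>s\<bar> ^ 2)))"
    define f where "f \<xi> = (cis (\<omega> \<xi> * t) - cis (\<omega>\<^sub>0 \<xi> * t)) * F \<xi>" for \<xi>
    define R where "R = C / \<bar>t\<bar> powr ((of_int q - 3) / (2 * of_int q)) * (A + B)"
    note hyps = that[folded I_def]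
    have bdd: "bdd_above ((\<lambda>x. norm (g x)) ` I)" if "bounded (g ` I)" for g :: "real \<Rightarrow> complex"
      using that by (auto simp: bounded_iff bdd_above_def)
    have leA: "norm (F x * of_real \<bar>x - \<xi>\<^sub>s\<bar>) \<le> A" if "x \<in> I" for x
      unfolding A_def by (rule cSUP_upper[OF that bdd[OF hyps(9)]])
    have leB: "norm (nth_deriv_on I 1 F x * of_real (\<bar>x - \<xi>\<^sub>s\<bar> ^ 2)) \<le> B" if "x \<in> I" for x
      unfolding B_def by (rule cSUP_upper[OF that bdd[OF hyps(10)]])
    have AB: "0 \<le> A" "0 \<le> B"
      using leA[OF hyps(6)] leB[OF hyps(6)] by auto
    have side: "norm (integral {0..c} (\<lambda>x. f (\<xi>\<^sub>s + \<sigma> * x))) \<le> R"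
      if \<sigma>: "\<bar>\<sigma>\<bar> = 1" and "0 \<le> c" and sub: "\<And>x. x \<in> {0..c} \<Longrightarrow> \<xi>\<^sub>s + \<sigma> * x \<in> I" for \<sigma> c
    proof -
      have dist: "\<bar>\<xi>\<^sub>s + \<sigma> * x - \<xi>\<^sub>s\<bar> = x" if "0 < x" for x
        using that \<sigma> by (simp add: abs_mult)
      have close_side: "\<bar>\<sigma> ^ l * nth_deriv_on I l \<omega> (\<xi>\<^sub>s + \<sigma> * x)
          - \<sigma> ^ l * nth_deriv_on I l \<omega>\<^sub>0 (\<xi>\<^sub>s + \<sigma> * x)\<bar> \<le> M * x powr (of_int q - real l)"
        if "l \<le> 2" "0 < x" "x \<le> c" for l x
      proof -
        have "\<xi>\<^sub>s + \<sigma> * x \<in> I - {\<xi>\<^sub>s}" using sub[of x] that \<sigma> by auto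
        then have "\<bar>nth_deriv_on I l \<omega> (\<xi>\<^sub>s + \<sigma> * x) - nth_deriv_on I l \<omega>\<^sub>0 (\<xi>\<^sub>s + \<sigma> * x)\<bar>
            * x powi (- q + int l) \<le> M"
          using hyps(11) \<open>l \<le> 2\<close> dist[OF \<open>0 < x\<close>] by metis
        from le_powr_of_powi_bound[OF this \<open>0 < x\<close>] show ?thesis
          using \<sigma> by (simp add: abs_mult power_abs flip: right_diff_distrib)
      qed
      note phase = smooth_phase_half_interval[OF \<sigma> \<open>0 \<le> c\<close> less_imp_le[OF \<open>\<kappa> > 0\<close>] sub
          hyps(1) bspec[OF hyps(4)] hyps(7)]
      note phase0 = smooth_phase_half_interval[OF \<sigma> \<open>0 \<le> c\<close> less_imp_le[OF \<open>\<kappa> > 0\<close>] sub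
          hyps(2) bspec[OF hyps(5)] hyps(8)]
      have "norm (integral {0..c} (\<lambda>x. (cis (\<sigma> ^ 0 * nth_deriv_on I 0 \<omega> (\<xi>\<^sub>s + \<sigma> * x) * t)
          - cis (\<sigma> ^ 0 * nth_deriv_on I 0 \<omega>\<^sub>0 (\<xi>\<^sub>s + \<sigma> * x) * t)) * F (\<xi>\<^sub>s + \<sigma> * x)))
        \<le> 18 * (M + 2) / sqrt \<kappa> / \<bar>t\<bar> powr ((of_int q - 3) / (2 * of_int q)) * (A + B)"
      proof (rule half_interval_estimate[OF \<open>0 \<le> c\<close> \<open>\<kappa> > 0\<close> AB \<open>M \<ge> 0\<close> _ _
            phase(1) phase(1)[of _ "Suc 0"] _ phase0(1) phase0(1)[of _ "Suc 0"]])
        show "((\<lambda>x. F (\<xi>\<^sub>s + \<sigma> * x)) has_vector_derivative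
            \<sigma> *\<^sub>R nth_deriv_on I 1 F (\<xi>\<^sub>s + \<sigma> * x)) (at x within {0..c})" if "x \<in> {0..c}" for x
          by (rule has_vector_derivative_affine)
            (use smooth_on_interval_derivative[OF hyps(3) sub[OF that], of 0] sub in auto)
        show "norm (F (\<xi>\<^sub>s + \<sigma> * x)) * x \<le> A" if "0 < x" "x \<le> c" for x
          using leA[of "\<xi>\<^sub>s + \<sigma> * x"] sub[of x] that dist[OF \<open>0 < x\<close>] by (simp add: norm_mult)
        show "norm (\<sigma> *\<^sub>R nth_deriv_on I 1 F (\<xi>\<^sub>s + \<sigma> * x)) * x\<^sup>2 \<le> B" if "0 < x" "x \<le> c" for x
          using leB[of "\<xi>\<^sub>s + \<sigma> * x"] sub[of x] that dist[OF \<open>0 < x\<close>] \<sigma>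
          by (simp add: norm_mult norm_power)
      qed (use phase(2) phase0(2) close_side[of 0] close_side[of "Suc 0"] t \<open>q > 3\<close>
          in \<open>simp_all add: numeral_2_eq_2\<close>)
      then show ?thesis by (simp add: f_def R_def C_def)
    qed
    have cont: "continuous_on I g" if "smooth_on_interval I g" for g :: "real \<Rightarrow> 'a::real_normed_vector"
      using smooth_on_interval_derivative[OF that, of _ 0]
      by (intro continuous_on_vector_derivative) auto
    have "continuous_on I f"
      unfolding f_def by (intro continuous_intros cont hyps)
    then have "integral I f = integral {0..\<xi>\<^sub>s - a} (\<lambda>x. f (\<xi>\<^sub>s + - 1 * x))
        + integral {0..b - \<xi>\<^sub>s} (\<lambda>x. f (\<xi>\<^sub>s + 1 * x))"
      unfolding I_def using \<xi> by (intro integral_split_reflect integrable_continuous_real) auto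
    moreover have "norm (integral {0..\<xi>\<^sub>s - a} (\<lambda>x. f (\<xi>\<^sub>s + - 1 * x))) \<le> R"
      using \<xi> by (intro side) (auto simp: I_def)
    moreover have "norm (integral {0..b - \<xi>\<^sub>s} (\<lambda>x. f (\<xi>\<^sub>s + 1 * x))) \<le> R"
      using \<xi> by (intro side) (auto simp: I_def)
    ultimately have "norm (integral I f) \<le> R + R"
      by (metis norm_triangle_le add_mono)
    then show ?thesis
      unfolding f_def cis_conv_exp by (simp add: R_def A_def B_def I_def)
  qed
  have "2 * C > 0" using assms by (simp add: C_def)
  show ?thesis
    by (rule exI[of _ 1], rule conjI, simp, rule exI[of _ "2 * C"], rule conjI, fact \<open>2 * C > 0\<close>,
        unfold Let_def, intro allI impI, rule main) auto
qed

end
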